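(* Let $s$ and $q$ be integers with $1\le q\le s$, and let $n=T_s+q$. If $\lambda\vdash n$ satisfies $\deg(\lambda)=\Delta_n$, then $\operatorname{supp}(\lambda)=s$, i.e. $\lambda$ has exactly $s$ distinct part sizes.
   Context: For an integer $m\ge 0$, $T_m:=m(m+1)/2$. For a partition $\lambda$, $\operatorname{supp}(\lambda)$ denotes the number of distinct part sizes of $\lambda$. Partition graph: for $n\ge 1$, $G_n$ is the simple graph whose vertices are the integer partitions of $n$; two distinct partitions are adjacent if one is obtained from the other by an elementary transfer of one unit from one part to another (subtract $1$ from one part and add $1$ to another part), followed by reordering. Here the receiving part may be a zero part (so a new part $1$ may be created), and parts that become $0$ are discarded. $\deg(\lambda)$ is the degree of $\lambda$ in $G_n$, and $\Delta_n:=\max_{\lambda\vdash n}\deg(\lambda)$. *)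

theory Defs
  imports Main "HOL-Library.Multiset"
begin

definition T :: "nat \<Rightarrow> nat" where
  "T m = m * (m + 1) div 2"

text \<open>A partition is represented by the multiset of its (positive) parts, so that
  reordering of parts is immaterial.\<close>

definition partitions :: "nat \<Rightarrow> nat multiset set" where
  "partitions n = {\<mu>. 0 \<notin># \<mu> \<and> sum_mset \<mu> = n}"

definition supp :: "nat multiset \<Rightarrow> nat" where
  "supp \<mu> = card (set_mset \<mu>)"

text \<open>One unit is moved from a part \<open>a\<close> to another part \<open>b\<close>. The two parts are distinct
  occurrences but may have equal size. Adjoining one zero part to \<open>\<mu>\<close> allows the
  receiving part \<open>b\<close> to be zero; the filter discards the parts that are zero afterwards.\<close>

definition transfer :: "nat multiset \<Rightarrow> nat multiset \<Rightarrow> bool" where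
  "transfer \<mu> \<nu> \<longleftrightarrow>
    (\<exists>a b. a \<in># \<mu> \<and> b \<in># add_mset 0 \<mu> - {#a#} \<and>
      \<nu> = filter_mset (\<lambda>x. x > 0) (add_mset 0 \<mu> - {#a, b#} + {#a - 1, b + 1#}))"

text \<open>The partition graph has vertex set \<open>partitions n\<close>; its edges are unordered pairs
  of vertices.\<close>

definition edges :: "nat \<Rightarrow> nat multiset set set" where
  "edges n = {{\<mu>, \<nu>} | \<mu> \<nu>. \<mu> \<in> partitions n \<and> \<nu> \<in> partitions n \<and> \<mu> \<noteq> \<nu> \<and>
    (transfer \<mu> \<nu> \<or> transfer \<nu> \<mu>)}"

definition deg :: "nat \<Rightarrow> nat multiset \<Rightarrow> nat" where
  "deg n \<mu> = card {\<nu> \<in> partitions n. {\<mu>, \<nu>} \<in> edges n}"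

definition max_deg :: "nat \<Rightarrow> nat" where
  "max_deg n = Max (deg n ` partitions n)"

text \<open>The cardinality and the maximum above range over finite sets, and the maximum over a
  nonempty one.\<close>

lemma finite_partitions: "finite (partitions n)"
proof -
  have size_le: "size \<mu> \<le> sum_mset \<mu>" if "0 \<notin># \<mu>" for \<mu> :: "nat multiset"
    using that by (induction \<mu>) auto
  have "partitions n \<subseteq> mset ` {xs. set xs \<subseteq> {..n} \<and> length xs \<le> n}"
  proof
    fix \<mu> assume p: "\<mu> \<in> partitions n"
    obtain xs where xs: "\<mu> = mset xs" by (metis ex_mset)
    have "set xs \<subseteq> {..n}"
      using p by (auto simp: partitions_def xs sum_mset_sum_list intro: member_le_sum_list)
    moreover have "length xs \<le> n"
      using p size_le[of \<mu>] by (simp add: partitions_def xs)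
    ultimately show "\<mu> \<in> mset ` {xs. set xs \<subseteq> {..n} \<and> length xs \<le> n}"
      using xs by blast
  qed
  then show ?thesis
    by (rule finite_subset) (intro finite_imageI finite_lists_length_le, simp)
qed

lemma partitions_nonempty: "partitions n \<noteq> {}"
proof -
  have "replicate_mset n 1 \<in> partitions n"
    by (simp add: partitions_def)
  then show ?thesis by blast
qed

end

theory Submission imports Defs begin

text \<open>
  A neighbour of a partition is determined by the donating part size and by the receiving part
  size, which may be zero, so a partition with \<open>k\<close> part sizes has degree at most
  \<open>k(k + 1)\<close>. As \<open>n < T(s + 1)\<close>, we have \<open>k \<le> s\<close>, and for \<open>k < s\<close> the degree
  is at most \<open>s(s - 1)\<close>. On the other hand the staircase \<open>1, \<dots>, s\<close> with \<open>q\<close>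
  repeated is a partition of \<open>n\<close> of degree at least \<open>s(s - 1) + 1\<close>: of the \<open>s(s + 1)\<close>
  pairs \<open>(a, b)\<close> only the \<open>s\<close> pairs with \<open>b = a - 1\<close> and the \<open>s - 1\<close> pairs with
  \<open>b = a \<noteq> q\<close> are lost, and the others lead to distinct neighbours.
\<close>

text \<open>The outcome of a transfer as a function of the two part sizes, so that neighbours can be
  counted by pairs.\<close>

definition move :: "nat multiset \<Rightarrow> nat \<Rightarrow> nat \<Rightarrow> nat multiset" where
  "move \<mu> a b = filter_mset (\<lambda>x. x > 0) (add_mset 0 \<mu> - {#a, b#} + {#a - 1, b + 1#})"

lemma transfer_iff_move:
  "transfer \<mu> \<nu> \<longleftrightarrow> (\<exists>a b. a \<in># \<mu> \<and> b \<in># add_mset 0 \<mu> - {#a#} \<and> \<nu> = move \<mu> a b)"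
  by (simp add: transfer_def move_def)

text \<open>Naming the untouched parts \<open>R\<close> removes multiset subtraction from later
  computations.\<close>

lemma add_mset_zero_splitE:
  assumes "a \<in># \<mu>" and "b \<in># add_mset 0 \<mu> - {#a#}"
  obtains R where "add_mset (0::nat) \<mu> = add_mset a (add_mset b R)"
    and "move \<mu> a b = filter_mset (\<lambda>x. x > 0) (add_mset (a - 1) (add_mset (b + 1) R))"
proof -
  define R where "R = add_mset 0 \<mu> - {#a#} - {#b#}"
  have eq: "add_mset 0 \<mu> = add_mset a (add_mset b R)"
    unfolding R_def using assms by (metis insert_DiffM insertI2 set_mset_add_mset_insert)
  then have "move \<mu> a b = filter_mset (\<lambda>x. x > 0) (add_mset (a - 1) (add_mset (b + 1) R))"
    by (simp add: move_def)
  with eq that show thesis by blast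
qed

lemma filter_pos_eq_self: "0 \<notin># \<mu> \<Longrightarrow> filter_mset (\<lambda>x::nat. x > 0) \<mu> = \<mu>"
  by (intro filter_mset_eq_conv[THEN iffD2]) (auto intro: gr0I)

text \<open>The unit is moved back from \<open>b + 1\<close> to \<open>a - 1\<close>. Hence every
  neighbour arises by a transfer out of the given partition.\<close>

lemma transfer_sym:
  assumes "transfer \<mu> \<nu>" and "0 \<notin># \<mu>"
  shows "transfer \<nu> \<mu>"
proof -
  obtain a b where ab: "a \<in># \<mu>" "b \<in># add_mset 0 \<mu> - {#a#}" "\<nu> = move \<mu> a b"
    using assms(1) by (auto simp: transfer_iff_move)
  obtain R where R: "add_mset 0 \<mu> = add_mset a (add_mset b R)"
    and \<nu>: "\<nu> = filter_mset (\<lambda>x. x > 0) (add_mset (a - 1) (add_mset (b + 1) R))"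
    using add_mset_zero_splitE[OF ab(1,2)] ab(3) by metis
  have a: "a > 0" using ab(1) assms(2) by (cases a) auto
  have "\<mu> = filter_mset (\<lambda>x. x > 0) (add_mset 0 \<mu>)"
    using assms(2) by (simp add: filter_pos_eq_self)
  then have \<mu>: "\<mu> = filter_mset (\<lambda>x. x > 0) (add_mset a (add_mset b R))"
    by (simp only: R)
  have 1: "b + 1 \<in># \<nu>" by (simp add: \<nu>)
  \<comment> \<open>If \<open>a = 1\<close>, the donor was discarded and the adjoined zero part
    receives the unit.\<close>
  have 2: "a - 1 \<in># add_mset 0 \<nu> - {#b + 1#}"
    by (cases "a = 1") (auto simp: \<nu>)
  have "\<mu> = move \<nu> (b + 1) (a - 1)"
    using a by (cases "a = 1") (auto simp: \<mu> \<nu> move_def filter_filter_mset)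
  with 1 2 show ?thesis unfolding transfer_iff_move by blast
qed

lemma move_in_partitions:
  assumes "\<mu> \<in> partitions n" and "a \<in># \<mu>" and "b \<in># add_mset 0 \<mu> - {#a#}"
  shows "move \<mu> a b \<in> partitions n"
proof -
  obtain R where R: "add_mset 0 \<mu> = add_mset a (add_mset b R)"
    and m: "move \<mu> a b = filter_mset (\<lambda>x. x > 0) (add_mset (a - 1) (add_mset (b + 1) R))"
    using add_mset_zero_splitE[OF assms(2,3)] .
  have a: "a > 0" using assms(1,2) by (cases a) (auto simp: partitions_def)
  have filt: "sum_mset (filter_mset (\<lambda>x. x > 0) M) = sum_mset M" for M :: "nat multiset"
    by (induction M) auto
  have "sum_mset (move \<mu> a b) = sum_mset (add_mset a (add_mset b R))"
    unfolding m filt using a by simp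
  also have "\<dots> = n" using assms(1) by (simp add: R[symmetric] partitions_def)
  finally show ?thesis by (simp add: partitions_def m)
qed

text \<open>For \<open>y > 0\<close> this is entry \<open>y\<close> of the conjugate
  partition.\<close>

definition parts_ge :: "nat multiset \<Rightarrow> nat \<Rightarrow> nat" where
  "parts_ge \<mu> y = size (filter_mset (\<lambda>x. y \<le> x) \<mu>)"

text \<open>On the conjugate partition, a transfer removes a unit from entry \<open>a\<close> and adds one to
  entry \<open>b + 1\<close>, so \<open>a\<close> and \<open>b\<close> can be read off.\<close>

lemma parts_ge_move:
  assumes "0 \<notin># \<mu>" and "a \<in># \<mu>" and "b \<in># add_mset 0 \<mu> - {#a#}" and "y > 0"
  shows "parts_ge (move \<mu> a b) y + of_bool (y = a) = parts_ge \<mu> y + of_bool (y = b + 1)"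
proof -
  obtain R where R: "add_mset 0 \<mu> = add_mset a (add_mset b R)"
    and m: "move \<mu> a b = filter_mset (\<lambda>x. x > 0) (add_mset (a - 1) (add_mset (b + 1) R))"
    using add_mset_zero_splitE[OF assms(2,3)] .
  \<comment> \<open>For \<open>y > 0\<close>, neither adjoining nor discarding zeros affects the
    count.\<close>
  have "parts_ge (add_mset 0 \<mu>) y = parts_ge \<mu> y" using \<open>y > 0\<close> by (simp add: parts_ge_def)
  moreover have "parts_ge (filter_mset (\<lambda>x. x > 0) M) y = parts_ge M y" for M
    using \<open>y > 0\<close> by (auto simp: parts_ge_def filter_filter_mset intro!: arg_cong[where f = size] filter_mset_cong)
  moreover have "a > 0" using assms(1,2) by (cases a) auto
  ultimately show ?thesis
    using \<open>y > 0\<close> unfolding m R by (auto simp: parts_ge_def split: if_splits)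
qed

text \<open>The condition \<open>a \<noteq> b + 1\<close> excludes the transfers that only swap two
  sizes and so return \<open>\<mu>\<close>.\<close>

definition movable :: "nat multiset \<Rightarrow> (nat \<times> nat) set" where
  "movable \<mu> = {(a, b). a \<in># \<mu> \<and> b \<in># add_mset 0 \<mu> - {#a#} \<and> a \<noteq> b + 1}"

text \<open>The gain at entry \<open>b + 1\<close> of the conjugate is not cancelled by the loss at
  entry \<open>a\<close>.\<close>

lemma move_neq:
  assumes "0 \<notin># \<mu>" and "(a, b) \<in> movable \<mu>"
  shows "move \<mu> a b \<noteq> \<mu>"
  using parts_ge_move[OF assms(1), of a b "b + 1"] assms(2) by (auto simp: movable_def)

lemma inj_on_move:
  assumes "0 \<notin># \<mu>"
  shows "inj_on (\<lambda>(a, b). move \<mu> a b) (movable \<mu>)"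
proof (rule inj_onI, clarify)
  fix a b c d
  assume ab: "(a, b) \<in> movable \<mu>" and cd: "(c, d) \<in> movable \<mu>"
    and eq: "move \<mu> a b = move \<mu> c d"
  have "of_bool (y = b + 1) + of_bool (y = c) = (of_bool (y = d + 1) + of_bool (y = a) :: nat)"
    if "y > 0" for y
    using parts_ge_move[OF assms, of a b y] parts_ge_move[OF assms, of c d y] ab cd eq that
    by (auto simp: movable_def)
  \<comment> \<open>As \<open>a \<noteq> b + 1\<close> and \<open>c \<noteq> d + 1\<close>, loss and
    gain never cancel: \<open>y = a\<close> forces \<open>a = c\<close>, and
    \<open>y = b + 1\<close> forces \<open>b = d\<close>.\<close>
  from this[of a] this[of "b + 1"] show "a = c \<and> b = d"
    using ab cd assms by (cases a) (auto simp: movable_def of_bool_def split: if_splits)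
qed

lemma deg_le:
  assumes "\<mu> \<in> partitions n"
  shows "deg n \<mu> \<le> supp \<mu> * (supp \<mu> + 1)"
proof -
  have zero: "0 \<notin># \<nu>" if "\<nu> \<in> partitions n" for \<nu> using that by (simp add: partitions_def)
  let ?P = "set_mset \<mu> \<times> insert 0 (set_mset \<mu>)"
  have "{\<nu> \<in> partitions n. {\<mu>, \<nu>} \<in> edges n} \<subseteq> (\<lambda>(a, b). move \<mu> a b) ` ?P"
  proof clarify
    fix \<nu> assume "\<nu> \<in> partitions n" "{\<mu>, \<nu>} \<in> edges n"
    then have "transfer \<mu> \<nu>"
      using transfer_sym zero by (fastforce simp: edges_def doubleton_eq_iff)
    then obtain a b where "a \<in># \<mu>" "b \<in># add_mset 0 \<mu> - {#a#}" "\<nu> = move \<mu> a b"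
      by (auto simp: transfer_iff_move)
    then show "\<nu> \<in> (\<lambda>(a, b). move \<mu> a b) ` ?P"
      by (auto intro!: image_eqI[of _ _ "(a, b)"] dest: in_diffD)
  qed
  then have "deg n \<mu> \<le> card ((\<lambda>(a, b). move \<mu> a b) ` ?P)"
    unfolding deg_def by (intro card_mono) auto
  also have "\<dots> \<le> card ?P" by (intro card_image_le) auto
  also have "\<dots> = supp \<mu> * (supp \<mu> + 1)"
    using zero[OF assms] by (simp add: card_cartesian_product supp_def)
  finally show ?thesis .
qed

lemma card_movable_le_deg:
  assumes "\<mu> \<in> partitions n"
  shows "card (movable \<mu>) \<le> deg n \<mu>"
proof -
  have zero: "0 \<notin># \<mu>" using assms by (simp add: partitions_def)
  have "{\<mu>, move \<mu> a b} \<in> edges n" if "(a, b) \<in> movable \<mu>" for a b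
    using that assms move_in_partitions[OF assms] move_neq[OF zero that]
    unfolding edges_def movable_def transfer_iff_move by blast
  then have sub: "(\<lambda>(a, b). move \<mu> a b) ` movable \<mu> \<subseteq> {\<nu> \<in> partitions n. {\<mu>, \<nu>} \<in> edges n}"
    using move_in_partitions[OF assms] by (auto simp: movable_def)
  have "card (movable \<mu>) = card ((\<lambda>(a, b). move \<mu> a b) ` movable \<mu>)"
    by (simp add: card_image[OF inj_on_move[OF zero]])
  also have "\<dots> \<le> deg n \<mu>"
    unfolding deg_def by (intro card_mono sub) (simp add: finite_partitions)
  finally show ?thesis .
qed

lemma T_Suc: "T (Suc k) = T k + Suc k"
  by (simp add: T_def)

lemma T_mono: "k \<le> l \<Longrightarrow> T k \<le> T l"
  by (rule lift_Suc_mono_le[of T]) (auto simp: T_Suc)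

lemma sum_atLeast1_eq_T: "\<Sum>{1..k} = T k"
  by (induction k) (simp_all add: T_Suc, simp add: T_def)

text \<open>A set of positive numbers with maximum \<open>m\<close> lies in \<open>{1..m}\<close>,
  so \<open>m\<close> is at least its cardinality, which is the last increment of
  \<open>T\<close>.\<close>

lemma T_card_le_sum:
  assumes "finite S" and "0 \<notin> S"
  shows "T (card S) \<le> \<Sum>S"
  using assms
proof (induction S rule: finite_linorder_max_induct)
  case empty
  then show ?case by (simp add: T_def)
next
  case (insert m S)
  have "insert m S \<subseteq> {1..m}" using insert.hyps insert.prems
    by (auto simp: Suc_le_eq less_imp_le intro: gr0I)
  from card_mono[OF _ this] have "card (insert m S) \<le> m" by simp
  moreover have "m \<notin> S" using insert.hyps by auto
  ultimately show ?case using insert by (simp add: T_Suc)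
qed

text \<open>Keeping one copy of each part size leaves distinct positive numbers with sum at most
  \<open>n\<close>.\<close>

lemma T_supp_le:
  assumes "\<mu> \<in> partitions n"
  shows "T (supp \<mu>) \<le> n"
proof -
  have "T (supp \<mu>) \<le> \<Sum>(set_mset \<mu>)"
    unfolding supp_def using assms by (intro T_card_le_sum) (auto simp: partitions_def)
  also have "\<Sum>(set_mset \<mu>) = sum_mset (mset_set (set_mset \<mu>))"
    by (simp add: sum_unfold_sum_mset)
  also have "\<dots> \<le> sum_mset \<mu>"
    using mset_set_set_mset_msubset[of \<mu>]
    by (metis le_add1 mset_subset_eq_exists_conv sum_mset.union)
  also have "\<dots> = n" using assms by (simp add: partitions_def)
  finally show ?thesis .
qed

lemma card_movable_staircase:
  assumes "1 \<le> q" and "q \<le> s"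
  shows "s * (s - 1) < card (movable (add_mset q (mset_set {1..s})))"
    (is "_ < card (movable ?\<mu>)")
proof -
  let ?A = "{1..s} \<times> {0..s}" and ?B = "(\<lambda>a. (a, a - 1)) ` {1..s}"
    and ?C = "(\<lambda>a. (a, a)) ` ({1..s} - {q})"
  \<comment> \<open>A pair \<open>(a, a)\<close> needs two copies of \<open>a\<close>, which only
    \<open>q\<close> has.\<close>
  have sub: "?A - (?B \<union> ?C) \<subseteq> movable ?\<mu>"
    using assms by (auto simp: movable_def in_diff_count count_mset_set' split: if_splits)
  have fin: "finite (movable ?\<mu>)"
  proof (rule finite_subset)
    show "movable ?\<mu> \<subseteq> set_mset ?\<mu> \<times> insert 0 (set_mset ?\<mu>)"
      unfolding movable_def by (auto dest: in_diffD)
  qed simp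
  have "card (?B \<union> ?C) \<le> card ?B + card ?C" by (rule card_Un_le)
  also have "\<dots> \<le> s + (s - 1)"
    using assms card_image_le[of "{1..s}" "\<lambda>a. (a, a - 1)"]
      card_image_le[of "{1..s} - {q}" "\<lambda>a. (a, a)"] by simp
  finally have "card ?A - (s + (s - 1)) \<le> card (?A - (?B \<union> ?C))"
    using diff_card_le_card_Diff[of "?B \<union> ?C" ?A] by simp
  \<comment> \<open>The right side is
    \<open>s * (s + 1) - (2 * s - 1) = s * (s - 1) + 1\<close>.\<close>
  moreover have "s * (s - 1) < card ?A - (s + (s - 1))"
    using assms by (cases s) auto
  ultimately show ?thesis using card_mono[OF fin sub] by linarith
qed

theorem theorem3p2:
  fixes s q n :: nat and \<mu> :: "nat multiset"
  assumes "1 \<le> q" and "q \<le> s"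
    and "n = T s + q"
    and "\<mu> \<in> partitions n"
    and "deg n \<mu> = max_deg n"
  shows "supp \<mu> = s"
proof (rule antisym)
  show "supp \<mu> \<le> s"
  proof (rule ccontr)
    assume "\<not> supp \<mu> \<le> s"
    \<comment> \<open>Since \<open>q \<le> s\<close>, the left side \<open>T s + s + 1\<close>
      exceeds \<open>n\<close>.\<close>
    then have "T (Suc s) \<le> T (supp \<mu>)" by (intro T_mono) simp
    then show False using T_supp_le[OF assms(4)] assms(2,3) by (simp add: T_Suc)
  qed
  show "s \<le> supp \<mu>"
  proof (rule ccontr)
    assume "\<not> s \<le> supp \<mu>"
    then have "supp \<mu> * (supp \<mu> + 1) \<le> (s - 1) * s" by (intro mult_le_mono) auto
    then have less: "deg n \<mu> \<le> s * (s - 1)"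
      using deg_le[OF assms(4)] by (simp add: mult.commute)
    let ?\<nu> = "add_mset q (mset_set {1..s})"
    have \<nu>: "?\<nu> \<in> partitions n"
      using assms(1,3) sum_atLeast1_eq_T[of s]
      by (auto simp: partitions_def sum_unfold_sum_mset)
    have "s * (s - 1) < deg n ?\<nu>"
      using card_movable_staircase[OF assms(1,2)] card_movable_le_deg[OF \<nu>] by linarith
    also have "\<dots> \<le> max_deg n"
      unfolding max_deg_def using \<nu> by (intro Max_ge) (auto simp: finite_partitions)
    finally show False using less assms(5) by simp
  qed
qed

end
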